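(* (a) The only Littlewood polynomials admitting negative step roots are of the form $1-x-x^2-\cdots-x^{2n}$ for some $n\in\mathbb N$, and the step roots are the numbers $x_n$, where $x_n$ denotes the unique negative root of $1-x-x^2-\cdots-x^{2n}$. (b) There are no step roots in $[-1,1/2]\cup(1,2)$. (c) The step roots are dense in $(1/2,1]$.
   Context: A Littlewood polynomial is a polynomial all of whose coefficients are $-1$ or $+1$. Given $n\in\mathbb N=\{1,2,\dots\}$ and a Littlewood polynomial $P_n(x)=\sum_{m=0}^n\rho_mx^m$ with coefficients $\rho_m\in\{-1,+1\}$, write $P_k(x)=\sum_{m=0}^k\rho_mx^m$ for $k\le n$. A number $\alpha\in\mathbb R$ is called a step root of $P_n$ if $P_n(\alpha)=0$ and $\rho_{k+1}P_k(\alpha)\le0$ for $k=0,\dots,n-1$. In (b) and (c), "step roots" means step roots of arbitrary Littlewood polynomials. For each $n\in\mathbb N$, the polynomial $1-x-\cdots-x^{2n}$ has exactly one negative root $x_n$; the sequence $(x_n)$ is strictly increasing, lies in $(-2,-1)$, and converges to $-1$.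
   Formalization: In (a) the classification is up to a global sign: the Littlewood polynomials with negative step roots are ±(1−x−…−x^{2n}), since e.g. −1+x+x² also has the negative step root x_1. *)

theory Defs
  imports Complex_Main "HOL-Computational_Algebra.Polynomial" "HOL-Analysis.Elementary_Topology"
begin

definition littlewood :: "real poly \<Rightarrow> bool" where
  "littlewood p \<longleftrightarrow> (\<forall>m\<le>degree p. coeff p m \<in> {-1, 1})"

text \<open>For \<open>p\<close> with coefficients \<open>\<rho>\<^sub>m\<close>, the partial polynomial \<open>P\<^sub>k\<close> consisting of
  the terms of degree at most \<open>k\<close> is \<open>poly_cutoff (Suc k) p\<close>.\<close>

definition step_root :: "real poly \<Rightarrow> real \<Rightarrow> bool" where
  "step_root p \<alpha> \<longleftrightarrow>
     littlewood p \<and> degree p \<ge> 1 \<and> poly p \<alpha> = 0 \<and>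
     (\<forall>k<degree p. coeff p (Suc k) * poly (poly_cutoff (Suc k) p) \<alpha> \<le> 0)"

text \<open>The condition is invariant under \<open>p \<mapsto> - p\<close>, so classifications of the polynomials
  with given step roots hold up to a global sign.\<close>

definition step_roots :: "real set" where
  "step_roots = {\<alpha>. \<exists>p. step_root p \<alpha>}"

definition L :: "nat \<Rightarrow> real poly" where
  "L n = 1 - (\<Sum>m=1..2*n. monom 1 m)"

definition neg_root :: "nat \<Rightarrow> real" where
  "neg_root n = (THE x. x < 0 \<and> poly (L n) x = 0)"

lemma poly_L: "poly (L n) x = 1 - (\<Sum>m=1..2*n. x ^ m)"
  by (simp add: L_def poly_sum poly_monom)

lemma poly_L_mult: "(1 - x) * poly (L n) x = 1 - 2 * x + x ^ (2 * n + 1)"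
proof -
  have "(1 - x) * (1 - (\<Sum>m=1..k. x ^ m)) = 1 - 2 * x + x ^ (k + 1)" for k
    by (induction k) (auto simp: algebra_simps)
  then show ?thesis by (simp add: poly_L)
qed

text \<open>The description in the definition of \<open>neg_root\<close> is proper for \<open>n \<ge> 1\<close>.\<close>

lemma ex1_neg_root:
  assumes "n \<ge> 1"
  shows "\<exists>!x. x < 0 \<and> poly (L n) x = 0"
proof -
  have root_iff: "poly (L n) x = 0 \<longleftrightarrow> (- x) ^ (2 * n) = 2 + 1 / (- x)" if "x < 0" for x
  proof -
    have "poly (L n) x = 0 \<longleftrightarrow> (1 - x) * poly (L n) x = 0" using that by simp
    also have "\<dots> \<longleftrightarrow> 1 - 2 * x + x ^ (2 * n + 1) = 0" by (simp only: poly_L_mult)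
    also have "\<dots> \<longleftrightarrow> (- x) ^ (2 * n) = 2 + 1 / (- x)"
      using that by (auto simp: field_simps)
    finally show ?thesis .
  qed
  have lt: False if "x < y" "y < 0" "poly (L n) x = 0" "poly (L n) y = 0" for x y
  proof -
    have "(- y) ^ (2 * n) < (- x) ^ (2 * n)"
      using that assms by (intro power_strict_mono) auto
    moreover have "1 / (- x) < 1 / (- y)"
      using that by (intro divide_strict_left_mono) (auto simp: mult_neg_neg)
    ultimately show False using root_iff[of x] root_iff[of y] that by linarith
  qed
  have "(2::real) ^ 3 \<le> 2 ^ (2 * n + 1)" using assms by (intro power_increasing) auto
  then have "(1 - (- 2)) * poly (L n) (- 2) < 0" unfolding poly_L_mult by simp
  then have "poly (L n) (- 2) < 0" by (simp add: mult_less_0_iff)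
  moreover have "poly (L n) 0 > 0" using poly_L_mult[of 0 n] by simp
  ultimately obtain x where "x < 0" "poly (L n) x = 0"
    using poly_IVT_pos[of "-2" 0 "L n"] by auto
  then show ?thesis using lt by (metis linorder_less_linear)
qed

end

theory Submission
  imports Defs "HOL-Complex_Analysis.Conformal_Mappings"
begin

text \<open>For a step root \<open>\<alpha>\<close> the signs are forced by the partial sums, so the numbers
  \<open>v\<^sub>k = \<bar>P\<^sub>k(\<alpha>)\<bar>\<close> satisfy an autonomous recursion: \<open>v\<^sub>k\<^sub>+\<^sub>1 = \<bar>v\<^sub>k - \<bar>\<alpha>\<bar>\<^sup>k\<^sup>+\<^sup>1\<bar>\<close>
  if \<open>\<alpha>\<^sup>k\<^sup>+\<^sup>1 > 0\<close>, and \<open>v\<^sub>k\<^sub>+\<^sub>1 = v\<^sub>k + \<bar>\<alpha>\<bar>\<^sup>k\<^sup>+\<^sup>1\<close> otherwise. For \<open>\<alpha> = - a < -1\<close>, once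
  \<open>v\<^sub>2\<^sub>k < a\<^sup>2\<^sup>k\<^sup>+\<^sup>1(a - 1)\<close>, this inequality persists and \<open>v\<close> never vanishes again. So it
  fails at every even index before a zero, the partial sums keep the sign of \<open>P\<^sub>0\<close> up to
  there, and all later coefficients have the opposite sign.
  For the density, let the signs be chosen greedily. If no partial sum vanishes on an open
  interval, then by continuity the signs are constant there, and since \<open>v\<^sub>k \<le> \<alpha>\<^sup>k\<close> a fixed
  power series with coefficients \<open>\<plusminus>1\<close> vanishes on the interval, contradicting the identity
  theorem.\<close>

section \<open>Partial sums\<close>

lemma poly_poly_cutoff_Suc:
  "poly (poly_cutoff (Suc k) p) x =
     poly (poly_cutoff k p) x + coeff p k * (x::'a::comm_semiring_1) ^ k"
proof -
  have "poly_cutoff (Suc k) p = poly_cutoff k p + monom (coeff p k) k"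
    by (rule poly_eqI) (auto simp: coeff_poly_cutoff less_Suc_eq)
  then show ?thesis by (simp add: poly_monom)
qed

lemma poly_cutoff_zero_length [simp]: "poly_cutoff 0 p = 0"
  by (rule poly_eqI) (simp add: coeff_poly_cutoff)

lemma poly_cutoff_minus: "poly_cutoff n (- p) = - poly_cutoff n (p::'a::comm_ring poly)"
  by (rule poly_eqI) (simp add: coeff_poly_cutoff)

lemma poly_poly_cutoff: "poly (poly_cutoff k p) x = (\<Sum>m<k. coeff p m * (x::'a::comm_semiring_1) ^ m)"
  by (induction k) (simp_all add: poly_poly_cutoff_Suc)

lemma poly_cutoff_Suc_degree: "poly_cutoff (Suc (degree p)) p = p"
  by (rule poly_eqI) (auto simp: coeff_poly_cutoff coeff_eq_0)

text \<open>This allows the constant coefficient to be normalised to \<open>1\<close> and accounts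
  for the two signs in the classification.\<close>

lemma step_root_minus: "step_root (- p) \<alpha> \<longleftrightarrow> step_root p \<alpha>"
proof -
  have "- c \<in> {-1, 1} \<longleftrightarrow> c \<in> {-1, 1}" for c :: real
    by auto
  then have "littlewood (- p) \<longleftrightarrow> littlewood p"
    by (simp only: littlewood_def degree_minus coeff_minus)
  then show ?thesis
    by (simp add: step_root_def poly_cutoff_minus)
qed

text \<open>The sign \<open>c\<close> opposes \<open>s\<close>, so \<open>s + c * y\<close> equals
  \<open>\<bar>s\<bar> - y\<close> up to sign. As \<open>y\<close> may be negative, one formula
  covers both cases of the recursion.\<close>

lemma abs_add_step:
  fixes s c y :: real
  assumes "c \<in> {-1, 1}" "c * s \<le> 0"
  shows "\<bar>s + c * y\<bar> = \<bar>\<bar>s\<bar> - y\<bar>"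
  using assms by auto

definition abs_partial :: "real poly \<Rightarrow> real \<Rightarrow> nat \<Rightarrow> real" where
  "abs_partial p \<alpha> k = \<bar>poly (poly_cutoff (Suc k) p) \<alpha>\<bar>"

lemma abs_partial_0:
  assumes "step_root p \<alpha>"
  shows "abs_partial p \<alpha> 0 = 1"
proof -
  have "coeff p 0 \<in> {-1, 1}"
    using assms by (simp add: step_root_def littlewood_def)
  then show ?thesis
    by (auto simp: abs_partial_def poly_poly_cutoff_Suc)
qed

lemma abs_partial_Suc:
  assumes "step_root p \<alpha>" "k < degree p"
  shows "abs_partial p \<alpha> (Suc k) = \<bar>abs_partial p \<alpha> k - \<alpha> ^ Suc k\<bar>"
  using assms unfolding abs_partial_def poly_poly_cutoff_Suc[of "Suc k"]
  by (intro abs_add_step) (auto simp: step_root_def littlewood_def)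

lemma abs_partial_degree:
  assumes "step_root p \<alpha>"
  shows "abs_partial p \<alpha> (degree p) = 0"
  using assms by (simp add: abs_partial_def poly_cutoff_Suc_degree step_root_def)

lemma abs_partial_nonneg: "abs_partial p \<alpha> k \<ge> 0"
  by (simp add: abs_partial_def)

section \<open>Intervals without step roots\<close>

text \<open>Each new power is at least the current absolute value, so the recursion becomes
  \<open>v\<^sub>k\<^sub>+\<^sub>1 = \<alpha>\<^sup>k\<^sup>+\<^sup>1 - v\<^sub>k\<close>. It is
  solved by an alternating geometric sum, which is never zero.\<close>

lemma step_root_not_gt_1:
  assumes "\<alpha> > 1"
  shows "\<not> step_root p \<alpha>"
proof
  assume step: "step_root p \<alpha>"
  have "(\<alpha> + 1) * abs_partial p \<alpha> k = \<alpha> ^ Suc k + (-1) ^ k" if "k \<le> degree p" for k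
    using that
  proof (induction k)
    case 0
    then show ?case using abs_partial_0[OF step] by simp
  next
    case (Suc k)
    have "\<alpha> ^ Suc (Suc k) > 1"
      using assms by (intro one_less_power) auto
    moreover have "(-1::real) ^ k \<le> 1"
      by (cases "even k") auto
    \<comment> \<open>By the induction hypothesis this says
      \<open>abs_partial p \<alpha> k \<le> \<alpha> ^ Suc k\<close>, which fixes the sign inside
      the absolute value.\<close>
    ultimately have "\<alpha> ^ Suc k + (-1) ^ k \<le> (\<alpha> + 1) * \<alpha> ^ Suc k"
      by (simp add: algebra_simps)
    moreover have "(\<alpha> + 1) * abs_partial p \<alpha> (Suc k) =
        \<bar>(\<alpha> + 1) * abs_partial p \<alpha> k - (\<alpha> + 1) * \<alpha> ^ Suc k\<bar>"
      using assms abs_partial_Suc[OF step, of k] Suc.prems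
      by (simp add: abs_mult flip: right_diff_distrib)
    ultimately show ?case using Suc by (simp add: algebra_simps)
  qed
  from this[of "degree p"] have "\<alpha> ^ Suc (degree p) + (-1) ^ degree p = 0"
    using abs_partial_degree[OF step] by simp
  moreover have "\<alpha> ^ Suc (degree p) > 1"
    using assms by (intro one_less_power) auto
  moreover have "(-1::real) ^ degree p \<ge> -1"
    by (cases "even (degree p)") auto
  ultimately show False by linarith
qed

text \<open>Step \<open>Suc k\<close> subtracts at most \<open>(1/2) ^ Suc k\<close>, half of the
  lower bound \<open>(1/2) ^ k\<close>, so the other half survives.\<close>

lemma step_root_not_between_0_half:
  assumes "0 \<le> \<alpha>" "\<alpha> \<le> 1/2"
  shows "\<not> step_root p \<alpha>"
proof
  assume step: "step_root p \<alpha>"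
  have "abs_partial p \<alpha> k \<ge> (1/2) ^ k" if "k \<le> degree p" for k
    using that
  proof (induction k)
    case 0
    then show ?case using abs_partial_0[OF step] by simp
  next
    case (Suc k)
    have "\<alpha> ^ Suc k \<le> (1/2) ^ Suc k"
      using assms by (intro power_mono) auto
    moreover have "(1/2::real) ^ k = 2 * (1/2) ^ Suc k"
      by simp
    ultimately show ?case using Suc abs_partial_Suc[OF step, of k] by linarith
  qed
  from this[of "degree p"] have "(1/2::real) ^ degree p \<le> 0"
    using abs_partial_degree[OF step] by simp
  moreover have "(1/2::real) ^ degree p > 0"
    by simp
  ultimately show False by linarith
qed

lemma abs_partial_neg_odd:
  assumes "step_root p \<alpha>" "\<alpha> < 0" "2 * k < degree p"
  shows "abs_partial p \<alpha> (Suc (2 * k)) = abs_partial p \<alpha> (2 * k) + (- \<alpha>) ^ Suc (2 * k)"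
proof -
  have "\<alpha> ^ Suc (2 * k) = - ((- \<alpha>) ^ Suc (2 * k))"
    by (simp add: uminus_power_if)
  moreover have "(- \<alpha>) ^ Suc (2 * k) > 0"
    using assms(2) by (intro zero_less_power) simp
  ultimately show ?thesis
    using abs_partial_Suc[OF assms(1,3)] abs_partial_nonneg[of p \<alpha> "2 * k"] by linarith
qed

text \<open>With \<open>a = - \<alpha>\<close>, the odd step adds \<open>a ^ Suc (2 * k)\<close> and
  the even step subtracts \<open>a\<close> times as much. The sign of the net decrement is that of
  \<open>a - 1\<close>.\<close>

lemma abs_partial_neg_even:
  assumes "step_root p \<alpha>" "\<alpha> < 0" "Suc (2 * k) < degree p"
  shows "abs_partial p \<alpha> (2 * Suc k) =
    \<bar>abs_partial p \<alpha> (2 * k) - (- \<alpha>) ^ Suc (2 * k) * (- \<alpha> - 1)\<bar>"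
proof -
  have "abs_partial p \<alpha> (2 * Suc k) = \<bar>abs_partial p \<alpha> (Suc (2 * k)) - (- \<alpha>) ^ Suc (Suc (2 * k))\<bar>"
    using abs_partial_Suc[OF assms(1,3)] by (simp add: uminus_power_if)
  then show ?thesis
    using abs_partial_neg_odd[OF assms(1,2), of k] assms(3) by (simp add: algebra_simps)
qed

text \<open>Steps to odd indices add a positive amount, so a zero can only occur at an even
  index.\<close>

lemma negative_step_root_even_degree:
  assumes "step_root p \<alpha>" "\<alpha> < 0"
  obtains m where "m \<ge> 1" "degree p = 2 * m"
proof -
  have "even (degree p)"
  proof (rule ccontr)
    assume "odd (degree p)"
    then obtain k where k: "degree p = Suc (2 * k)"
      by (metis oddE Suc_eq_plus1)
    have "(- \<alpha>) ^ Suc (2 * k) > 0"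
      using assms(2) by (intro zero_less_power) simp
    then have "abs_partial p \<alpha> (degree p) > 0"
      using abs_partial_neg_odd[OF assms, of k] abs_partial_nonneg[of p \<alpha> "2 * k"] k by simp
    then show False using abs_partial_degree[OF assms(1)] by simp
  qed
  then show ?thesis
    using that assms(1) by (auto elim!: evenE simp: step_root_def)
qed

text \<open>Here the net decrement over two steps is nonpositive, so the even-indexed values never
  fall below the initial \<open>1\<close>.\<close>

lemma step_root_not_between_minus_1_0:
  assumes "-1 \<le> \<alpha>" "\<alpha> < 0"
  shows "\<not> step_root p \<alpha>"
proof
  assume step: "step_root p \<alpha>"
  obtain m where m: "degree p = 2 * m"
    using negative_step_root_even_degree[OF step assms(2)] by blast
  have "abs_partial p \<alpha> (2 * k) \<ge> 1" if "k \<le> m" for k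
    using that
  proof (induction k)
    case 0
    then show ?case using abs_partial_0[OF step] by simp
  next
    case (Suc k)
    have "(- \<alpha>) ^ Suc (2 * k) * (- \<alpha> - 1) \<le> 0"
      using assms by (intro mult_nonneg_nonpos zero_le_power) auto
    then show ?case
      using Suc abs_partial_neg_even[OF step assms(2), of k] m by linarith
  qed
  from this[of m] show False using abs_partial_degree[OF step] m by simp
qed

section \<open>Negative step roots\<close>

lemma coeff_L: "coeff (L n) k = (if k = 0 then 1 else if k \<le> 2 * n then -1 else 0)"
  by (cases k) (simp_all add: L_def coeff_sum)

lemma degree_L: "degree (L n) = 2 * n"
  by (intro antisym degree_le le_degree) (auto simp: coeff_L)

text \<open>A value below the decrement \<open>d\<close> is replaced by \<open>d\<close> minus that
  value, which is positive and at most \<open>d\<close>. The next decrement is larger than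
  \<open>d\<close>, so the situation repeats.\<close>

lemma abs_partial_overshoot:
  assumes "step_root p \<alpha>" "\<alpha> < -1"
    and "abs_partial p \<alpha> (2 * k) < (- \<alpha>) ^ Suc (2 * k) * (- \<alpha> - 1)"
    and "k < j" "2 * j \<le> degree p"
  shows "abs_partial p \<alpha> (2 * j) > 0 \<and>
    abs_partial p \<alpha> (2 * j) < (- \<alpha>) ^ Suc (2 * j) * (- \<alpha> - 1)"
proof -
  have step: "abs_partial p \<alpha> (2 * Suc i) > 0 \<and>
      abs_partial p \<alpha> (2 * Suc i) < (- \<alpha>) ^ Suc (2 * Suc i) * (- \<alpha> - 1)"
    if "abs_partial p \<alpha> (2 * i) < (- \<alpha>) ^ Suc (2 * i) * (- \<alpha> - 1)" "2 * Suc i \<le> degree p" for i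
  proof -
    have "(- \<alpha>) ^ Suc (2 * i) < (- \<alpha>) ^ Suc (2 * Suc i)"
      using assms(2) by (intro power_strict_increasing) auto
    then have "(- \<alpha>) ^ Suc (2 * i) * (- \<alpha> - 1) < (- \<alpha>) ^ Suc (2 * Suc i) * (- \<alpha> - 1)"
      using assms(2) by (intro mult_strict_right_mono) auto
    moreover have "abs_partial p \<alpha> (2 * Suc i) =
        \<bar>abs_partial p \<alpha> (2 * i) - (- \<alpha>) ^ Suc (2 * i) * (- \<alpha> - 1)\<bar>"
      using assms(2) that(2) by (intro abs_partial_neg_even assms(1)) auto
    ultimately show ?thesis
      using that(1) abs_partial_nonneg[of p \<alpha> "2 * i"] by (intro conjI) linarith+
  qed
  have "Suc k \<le> j" using assms(4) by simp
  then show ?thesis using assms(5)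
    by (induction j rule: dec_induct) (use step assms(3) in auto)
qed

lemma negative_step_root_imp_L:
  assumes "step_root p \<alpha>" "\<alpha> < 0" "coeff p 0 = 1"
  obtains n where "n \<ge> 1" "p = L n"
proof -
  obtain m where m: "m \<ge> 1" "degree p = 2 * m"
    using negative_step_root_even_degree[OF assms(1,2)] by blast
  have lt: "\<alpha> < -1"
    using step_root_not_between_minus_1_0[of \<alpha> p] assms(1,2) by linarith
  have "abs_partial p \<alpha> (2 * m) = 0"
    using abs_partial_degree[OF assms(1)] m by simp
  \<comment> \<open>A smaller value at some \<open>k < m\<close> would force
    \<open>abs_partial p \<alpha> (2 * m) > 0\<close>.\<close>
  then have large: "abs_partial p \<alpha> (2 * k) \<ge> (- \<alpha>) ^ Suc (2 * k) * (- \<alpha> - 1)" if "k < m" for k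
    using abs_partial_overshoot[OF assms(1) lt _ that] m by fastforce
  have pos: "0 < (- \<alpha>) ^ Suc (2 * k) * (- \<alpha> - 1)" for k
    using lt by (intro mult_pos_pos zero_less_power) auto
  let ?P = "\<lambda>k. poly (poly_cutoff (Suc k) p) \<alpha>"
  have minus: "coeff p (Suc k) = -1" if "k < degree p" "?P k > 0" for k
  proof -
    have "coeff p (Suc k) \<in> {-1, 1}" "coeff p (Suc k) * ?P k \<le> 0"
      using that assms(1) by (auto simp: step_root_def littlewood_def)
    then show ?thesis using that(2) by auto
  qed
  have odd_pos: "?P (Suc (2 * k)) = ?P (2 * k) + (- \<alpha>) ^ Suc (2 * k)"
    if "k < m" "?P (2 * k) > 0" for k
    using minus[of "2 * k"] that m
    by (simp add: poly_poly_cutoff_Suc[of "Suc (2 * k)"] uminus_power_if)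
  have P_pos: "?P (2 * k) > 0" if "k < m" for k
    using that
  proof (induction k)
    case 0
    then show ?case by (simp add: poly_poly_cutoff_Suc assms(3))
  next
    case (Suc k)
    have "(- \<alpha>) ^ Suc (2 * k) > 0"
      using assms(2) by (intro zero_less_power) auto
    then have "?P (Suc (2 * k)) > 0"
      using odd_pos[of k] Suc by simp
    then have "?P (2 * Suc k) = ?P (Suc (2 * k)) - (- \<alpha>) ^ Suc (Suc (2 * k))"
      using minus[of "Suc (2 * k)"] Suc.prems m
      by (simp add: poly_poly_cutoff_Suc[of "Suc (Suc (2 * k))"] uminus_power_if)
    also have "\<dots> = ?P (2 * k) - (- \<alpha>) ^ Suc (2 * k) * (- \<alpha> - 1)"
      using odd_pos[of k] Suc by (simp add: algebra_simps)
    also have "\<dots> \<ge> 0"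
      using large[of k] Suc by (simp add: abs_partial_def)
    finally have "?P (2 * Suc k) \<ge> 0" .
    \<comment> \<open>Strictness comes from the lower bound at the next index, available because
      \<open>Suc k < m\<close>; at \<open>m\<close> itself the sum vanishes.\<close>
    moreover have "abs_partial p \<alpha> (2 * Suc k) > 0"
      using large[OF Suc.prems] pos[of "Suc k"] by linarith
    ultimately show ?case by (simp add: abs_partial_def)
  qed
  have "?P k > 0" if "k < 2 * m" for k
  proof (cases "even k")
    case True
    then show ?thesis using P_pos that by (auto elim!: evenE)
  next
    case False
    then obtain i where i: "k = Suc (2 * i)"
      by (metis oddE Suc_eq_plus1)
    have "(- \<alpha>) ^ Suc (2 * i) > 0"
      using assms(2) by (intro zero_less_power) auto
    then show ?thesis using odd_pos[of i] P_pos[of i] that i by simp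
  qed
  then have "coeff p (Suc k) = -1" if "k < 2 * m" for k
    using minus[of k] m that by simp
  then have "p = L m"
    using assms(3) m by (intro poly_eqI) (auto simp: coeff_L coeff_eq_0 gr0_conv_Suc)
  with m(1) show ?thesis by (rule that)
qed

lemma neg_root:
  assumes "n \<ge> 1"
  shows "neg_root n < 0" "poly (L n) (neg_root n) = 0"
  using theI'[OF ex1_neg_root[OF assms]] unfolding neg_root_def by simp_all

lemma neg_root_eqI:
  assumes "n \<ge> 1" "x < 0" "poly (L n) x = 0"
  shows "neg_root n = x"
  unfolding neg_root_def using assms by (intro the1_equality ex1_neg_root) simp_all

text \<open>All nonconstant coefficients of \<open>L n\<close> are \<open>-1\<close>, so the step
  condition asks for nonnegative partial sums before the last.\<close>

lemma step_root_L_neg_root: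
  assumes "n \<ge> 1"
  shows "step_root (L n) (neg_root n)"
proof -
  define \<alpha> where "\<alpha> = neg_root n"
  have \<alpha>: "\<alpha> < 0" "poly (L n) \<alpha> = 0"
    using neg_root[OF assms] by (simp_all add: \<alpha>_def)
  let ?P = "\<lambda>k. poly (poly_cutoff (Suc k) (L n)) \<alpha>"
  have odd: "?P (Suc (2 * k)) = ?P (2 * k) + (- \<alpha>) ^ Suc (2 * k)" if "k < n" for k
    using that by (simp add: poly_poly_cutoff_Suc[of "Suc (2 * k)"] coeff_L uminus_power_if)
  have even: "?P (2 * Suc k) = ?P (2 * k) - (- \<alpha>) ^ Suc (2 * k) * (- \<alpha> - 1)" if "k < n" for k
  proof -
    have "?P (2 * Suc k) = ?P (Suc (2 * k)) - (- \<alpha>) ^ Suc (Suc (2 * k))"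
      using that by (simp add: poly_poly_cutoff_Suc[of "Suc (Suc (2 * k))"] coeff_L uminus_power_if)
    then show ?thesis using odd[OF that] by (simp add: algebra_simps)
  qed
  have root: "?P (2 * n) = 0"
    using \<alpha>(2) poly_cutoff_Suc_degree[of "L n"] by (simp add: degree_L)
  \<comment> \<open>Otherwise the even partial sums would not decrease, and
    \<open>?P (2 * n)\<close> would be at least \<open>1\<close>.\<close>
  have lt: "\<alpha> < -1"
  proof (rule ccontr)
    assume "\<not> \<alpha> < -1"
    then have neg: "(- \<alpha>) ^ Suc (2 * k) * (- \<alpha> - 1) \<le> 0" for k
      using \<alpha>(1) by (intro mult_nonneg_nonpos zero_le_power) auto
    have "?P (2 * k) \<ge> 1" if "k \<le> n" for k
      using that
    proof (induction k)
      case 0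
      then show ?case by (simp add: poly_poly_cutoff_Suc coeff_L)
    next
      case (Suc k)
      then show ?case using even[of k] neg[of k] by linarith
    qed
    from this[of n] root show False by simp
  qed
  have pos: "0 \<le> (- \<alpha>) ^ Suc (2 * k) * (- \<alpha> - 1)" for k
    using lt by (intro mult_nonneg_nonneg zero_le_power) auto
  \<comment> \<open>Downward induction from \<open>?P (2 * n) = 0\<close>: going back two indices
    adds a nonnegative decrement.\<close>
  have P_even: "?P (2 * k) \<ge> 0" if "k \<le> n" for k
    using that
  proof (induction k rule: inc_induct)
    case base
    then show ?case using root by simp
  next
    case (step k)
    then show ?case using even[of k] pos[of k] by linarith
  qed
  have "?P k \<ge> 0" if "k < 2 * n" for k
  proof (cases "even k")
    case True
    then show ?thesis using P_even that by (auto elim!: evenE)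
  next
    case False
    then obtain i where i: "k = Suc (2 * i)"
      by (metis oddE Suc_eq_plus1)
    have "(- \<alpha>) ^ Suc (2 * i) > 0"
      using \<alpha>(1) by (intro zero_less_power) auto
    then show ?thesis using odd[of i] P_even[of i] that i by simp
  qed
  then show ?thesis
    using \<alpha> assms
    by (auto simp: step_root_def littlewood_def degree_L coeff_L simp flip: \<alpha>_def)
qed

lemma negative_step_root_iff:
  "\<alpha> < 0 \<and> step_root p \<alpha> \<longleftrightarrow> (\<exists>n\<ge>1. (p = L n \<or> p = - L n) \<and> \<alpha> = neg_root n)"
proof
  assume *: "\<alpha> < 0 \<and> step_root p \<alpha>"
  then have "coeff p 0 = 1 \<or> coeff (- p) 0 = 1"
    by (auto simp: step_root_def littlewood_def)
  then have "\<exists>n\<ge>1. p = L n \<or> - p = L n"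
    using negative_step_root_imp_L[of p \<alpha>] negative_step_root_imp_L[of "- p" \<alpha>] *
    by (metis step_root_minus)
  then obtain n where n: "n \<ge> 1" "p = L n \<or> p = - L n"
    by (metis minus_minus)
  then have "poly (L n) \<alpha> = 0"
    using * by (auto simp: step_root_def)
  then show "\<exists>n\<ge>1. (p = L n \<or> p = - L n) \<and> \<alpha> = neg_root n"
    using n neg_root_eqI[of n \<alpha>] * by auto
next
  assume "\<exists>n\<ge>1. (p = L n \<or> p = - L n) \<and> \<alpha> = neg_root n"
  then show "\<alpha> < 0 \<and> step_root p \<alpha>"
    using step_root_L_neg_root neg_root(1) by (auto simp: step_root_minus)
qed

section \<open>Density\<close>

text \<open>For \<open>x > 0\<close> each sign drives the sum towards or past zero. At a zero sum,
  where the step condition admits both signs, \<open>1\<close> is chosen.\<close>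

fun greedy_sum :: "real \<Rightarrow> nat \<Rightarrow> real" where
  "greedy_sum x 0 = 1"
| "greedy_sum x (Suc k) = greedy_sum x k + (if greedy_sum x k > 0 then -1 else 1) * x ^ Suc k"

fun greedy_sign :: "real \<Rightarrow> nat \<Rightarrow> real" where
  "greedy_sign x 0 = 1"
| "greedy_sign x (Suc k) = (if greedy_sum x k > 0 then -1 else 1)"

lemma greedy_sign_cases: "greedy_sign x k \<in> {-1, 1}"
  by (cases k) auto

lemma greedy_sum_eq: "greedy_sum x k = (\<Sum>m<Suc k. greedy_sign x m * x ^ m)"
  by (induction k) auto

text \<open>Since \<open>x \<ge> 1/2\<close>, the old bound \<open>x ^ k\<close> is at most
  \<open>2 * x ^ Suc k\<close>; subtracting \<open>x ^ Suc k\<close> from a value between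
  \<open>0\<close> and that leaves at most \<open>x ^ Suc k\<close> in absolute value.\<close>

lemma abs_greedy_sum_le:
  assumes "1/2 \<le> x" "x \<le> 1"
  shows "\<bar>greedy_sum x k\<bar> \<le> x ^ k"
proof (induction k)
  case (Suc k)
  have "\<bar>greedy_sum x (Suc k)\<bar> = \<bar>\<bar>greedy_sum x k\<bar> - x ^ Suc k\<bar>"
    unfolding greedy_sum.simps by (rule abs_add_step) auto
  moreover have "x ^ k \<le> 2 * x ^ Suc k"
    using assms by (simp add: mult_left_le_one_le)
  moreover have "x ^ Suc k \<ge> 0"
    using assms by simp
  ultimately show ?case using Suc by linarith
qed simp

text \<open>Greedy signs satisfy the step condition by construction, so truncation at a vanishing
  sum gives a witness polynomial.\<close>

lemma step_root_if_greedy_sum_eq_0: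
  assumes "greedy_sum x n = 0"
  shows "x \<in> step_roots"
proof -
  define p where "p = (\<Sum>m<Suc n. monom (greedy_sign x m) m)"
  have c: "coeff p k = (if k \<le> n then greedy_sign x k else 0)" for k
    by (auto simp: p_def coeff_sum less_Suc_eq_le simp del: sum.lessThan_Suc)
  have "greedy_sign x n \<noteq> 0"
    using greedy_sign_cases[of x n] by auto
  then have deg: "degree p = n"
    by (intro antisym degree_le le_degree) (auto simp: c)
  have partial: "poly (poly_cutoff (Suc k) p) x = greedy_sum x k" if "k \<le> n" for k
    unfolding poly_poly_cutoff greedy_sum_eq using that by (intro sum.cong) (auto simp: c)
  have "n \<noteq> 0"
    using assms by (intro notI) simp
  moreover have "poly p x = 0"
    using partial[of n] assms poly_cutoff_Suc_degree[of p] deg by simp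
  ultimately have "step_root p x"
    using greedy_sign_cases[of x] by (auto simp: step_root_def littlewood_def deg c partial)
  then show ?thesis by (auto simp: step_roots_def)
qed

text \<open>The interval may avoid \<open>0\<close>, so the series is extended to the complex unit
  disc. There it vanishes on a set with an interior limit point, hence everywhere, in particular at
  \<open>0\<close>.\<close>

lemma power_series_zero_on_interval:
  fixes c :: "nat \<Rightarrow> real"
  assumes bound: "\<And>n. \<bar>c n\<bar> \<le> 1"
    and ab: "a < b" "-1 \<le> a" "b \<le> 1"
    and zero: "\<And>x. a < x \<Longrightarrow> x < b \<Longrightarrow> (\<lambda>n. c n * x ^ n) sums 0"
  shows "c 0 = 0"
proof -
  define f where "f z = (\<Sum>n. complex_of_real (c n) * z ^ n)" for z
  obtain m where m: "a < m" "m < b"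
    using dense[OF ab(1)] by blast
  have sums: "(\<lambda>n. complex_of_real (c n) * z ^ n) sums f z" if "norm z < 1" for z
  proof -
    have "summable (\<lambda>n. norm z ^ n)"
      using that by (intro summable_geometric) simp
    moreover have "norm (complex_of_real (c n) * z ^ n) \<le> norm z ^ n" for n
      using bound[of n] by (simp add: norm_mult norm_power mult_left_le_one_le)
    ultimately show ?thesis
      unfolding f_def by (rule summable_sums[OF summable_comparison_test'])
  qed
  have "f holomorphic_on ball 0 1"
    using sums by (intro power_series_holomorphic[where a = "\<lambda>n. complex_of_real (c n)"]) simp
  moreover have "complex_of_real m islimpt complex_of_real ` {a<..<b}"
    unfolding islimpt_approachable
  proof (intro allI impI)
    fix e :: real assume "e > 0"
    then obtain y where y: "m < y" "y < min b (m + e)"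
      using m dense[of m "min b (m + e)"] by auto
    then have "complex_of_real y \<in> complex_of_real ` {a<..<b}"
      using m by auto
    moreover have "complex_of_real y \<noteq> of_real m" "dist (complex_of_real y) (of_real m) < e"
      using y by (auto simp: dist_real_def)
    ultimately show "\<exists>z\<in>complex_of_real ` {a<..<b}. z \<noteq> of_real m \<and> dist z (of_real m) < e"
      by blast
  qed
  moreover have "f z = 0" if z: "z \<in> complex_of_real ` {a<..<b}" for z
  proof -
    obtain x where x: "z = of_real x" "a < x" "x < b" using z by auto
    have "(\<lambda>n. complex_of_real (c n * x ^ n)) sums of_real 0"
      using zero[OF x(2,3)] by (simp only: sums_of_real_iff)
    moreover have "(\<lambda>n. complex_of_real (c n * x ^ n)) sums f z"
      using sums[of z] x ab by simp
    ultimately have "of_real 0 = f z"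
      by (rule sums_unique2)
    then show ?thesis by simp
  qed
  moreover have "complex_of_real ` {a<..<b} \<subseteq> ball 0 1" "complex_of_real m \<in> ball 0 1"
    using ab m by auto
  ultimately have "f 0 = 0"
    by (intro analytic_continuation[of f "ball 0 1" "complex_of_real ` {a<..<b}" "of_real m" 0]) auto
  then show ?thesis by (simp add: f_def)
qed

lemma greedy_zero_in_interval:
  assumes "1/2 \<le> a" "a < b" "b \<le> 1"
  shows "\<exists>x n. a < x \<and> x < b \<and> greedy_sum x n = 0"
proof (rule ccontr)
  assume "\<not> ?thesis"
  then have nz: "greedy_sum x n \<noteq> 0" if "a < x" "x < b" for x n
    using that by blast
  define y where "y = (a + b) / 2"
  have y: "a < y" "y < b" using assms by (auto simp: y_def)
  have const: "greedy_sign x k = greedy_sign y k" if "a < x" "x < b" for x k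
    using that
  proof (induction k arbitrary: x rule: less_induct)
    case (less k)
    show ?case
    proof (cases k)
      case (Suc j)
      \<comment> \<open>By induction the signs up to index \<open>j\<close> are those at
        \<open>y\<close>, so on the interval \<open>greedy_sum\<close> agrees with one fixed
        polynomial and the intermediate value property applies.\<close>
      define q where "q u = (\<Sum>m<Suc j. greedy_sign y m * u ^ m)" for u
      have q: "greedy_sum u j = q u" if "a < u" "u < b" for u
        unfolding greedy_sum_eq q_def using less.IH that Suc by (intro sum.cong) auto
      have "connected (q ` {a<..<b})"
        unfolding q_def by (intro connected_continuous_image continuous_intros) auto
      moreover have "0 \<notin> q ` {a<..<b}"
        using nz q by force
      ultimately have "\<not> (q u \<le> 0 \<and> 0 \<le> q v)" if "u \<in> {a<..<b}" "v \<in> {a<..<b}" for u v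
        using connectedD_interval[of "q ` {a<..<b}" "q u" "q v" 0] that by blast
      from this[of x y] this[of y x] have "q x > 0 \<longleftrightarrow> q y > 0"
        using less.prems y by auto
      then show ?thesis
        using Suc q[OF less.prems] q[OF y] by simp
    qed simp
  qed
  have "(\<lambda>n. greedy_sign y n * x ^ n) sums 0" if x: "a < x" "x < b" for x
  proof -
    have "(\<lambda>k. x ^ k) \<longlonglongrightarrow> 0"
      using x assms by (intro LIMSEQ_power_zero) auto
    then have "(\<lambda>k. greedy_sum x k) \<longlonglongrightarrow> 0"
      by (rule Lim_null_comparison[rotated])
        (use abs_greedy_sum_le[of x] x assms in auto)
    \<comment> \<open>\<open>greedy_sum x k\<close> has \<open>Suc k\<close> terms, hence the index
      shift.\<close>
    then have "(\<lambda>n. \<Sum>m<n. greedy_sign x m * x ^ m) \<longlonglongrightarrow> 0"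
      unfolding greedy_sum_eq by (rule LIMSEQ_imp_Suc)
    then show ?thesis using const[OF x] by (simp add: sums_def)
  qed
  moreover have "\<bar>greedy_sign y n\<bar> \<le> 1" for n
    using greedy_sign_cases[of y n] by auto
  ultimately have "greedy_sign y 0 = 0"
    using assms by (intro power_series_zero_on_interval[of _ a b]) auto
  then show False by simp
qed

lemma step_roots_dense: "{1/2<..1} \<subseteq> closure (step_roots \<inter> {1/2<..1})"
proof
  fix t :: real assume t: "t \<in> {1/2<..1}"
  show "t \<in> closure (step_roots \<inter> {1/2<..1})"
    unfolding closure_approachable
  proof (intro allI impI)
    fix e :: real assume "e > 0"
    \<comment> \<open>Approximation from the left also handles \<open>t = 1\<close>; the maximum
      keeps \<open>x\<close> above \<open>1/2\<close>.\<close>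
    then obtain x n where x: "max (1/2) (t - e) < x" "x < t" "greedy_sum x n = 0"
      using greedy_zero_in_interval[of "max (1/2) (t - e)" t] t by auto
    then show "\<exists>y\<in>step_roots \<inter> {1/2<..1}. dist y t < e"
      using step_root_if_greedy_sum_eq_0[OF x(3)] t by (intro bexI[of _ x]) (auto simp: dist_real_def)
  qed
qed

theorem corollary4p4:
  shows "(\<forall>p \<alpha>. (\<alpha> < 0 \<and> step_root p \<alpha>) \<longleftrightarrow>
            (\<exists>n\<ge>1. (p = L n \<or> p = - L n) \<and> \<alpha> = neg_root n)) \<and>
         step_roots \<inter> ({-1..1/2} \<union> {1<..<2}) = {} \<and>
         {1/2<..1} \<subseteq> closure (step_roots \<inter> {1/2<..1})"
proof (intro conjI allI)
  show "(\<alpha> < 0 \<and> step_root p \<alpha>) \<longleftrightarrow>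
      (\<exists>n\<ge>1. (p = L n \<or> p = - L n) \<and> \<alpha> = neg_root n)" for p \<alpha>
    by (rule negative_step_root_iff)
  have "\<alpha> \<notin> {-1..1/2} \<union> {1<..<2}" if "step_root p \<alpha>" for p \<alpha>
    using that step_root_not_between_minus_1_0[of \<alpha> p] step_root_not_between_0_half[of \<alpha> p]
      step_root_not_gt_1[of \<alpha> p] by fastforce
  then show "step_roots \<inter> ({-1..1/2} \<union> {1<..<2}) = {}"
    by (auto simp: step_roots_def)
  show "{1/2<..1} \<subseteq> closure (step_roots \<inter> {1/2<..1})"
    by (rule step_roots_dense)
qed

end
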